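(* Let $n\ge1$ and let $S=\prod_{i=1}^n S_i$ be a product of sets. (1) For every $A\subseteq S$, the cylindrical core $A^{(0)}$ satisfies $A^{(0)}\subseteq A$ and $$A\,\Box\,B=A^{(0)}\,\Box\,B\qquad\text{for all }B\subseteq S\text{ with }B\neq S.\tag{$*$}$$ (2) If $A$ and $B$ are proper subsets of $S$, then $$A\,\Box\,B=A^{(0)}\,\Box\,B=A\,\Box\,B^{(0)}=A^{(0)}\,\Box\,B^{(0)}.$$ (3) If $|S_i|>1$ for all $i=1,\dots,n$, then for every $A\subseteq S$ the set $A^{(0)}$ is the smallest set satisfying $( * )$, in the sense that if $A^{(1)}\subseteq S$ satisfies $A\,\Box\,B=A^{(1)}\,\Box\,B$ for all $B\subseteq S$ with $B\ne S$, then $A^{(1)}\supseteq A^{(0)}$.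
   Context: Notation: $[n]=\{1,\dots,n\}$. For $K\subseteq[n]$ and $\mathbf x\in S$, the $K$-cylinder of $\mathbf x$ is $[\mathbf x]_K=\{\mathbf y\in S:y_i=x_i\ \forall i\in K\}$. The box operation on subsets of $S$ is $$A\,\Box\,B=\{\mathbf x\in S:\text{there exist disjoint }K,L\subseteq[n]\text{ such that }[\mathbf x]_K\subseteq A,\ [\mathbf x]_L\subseteq B\}.$$ The cylindrical core of $E\subseteq S$ is $$E^{(0)}=\bigcup_{(\mathbf x,K):\ \mathbf x\in S,\ K\subseteq[n],\ 0\le|K|\le n-1,\ [\mathbf x]_K\subseteq E}[\mathbf x]_K.$$ *)

theory Defs
  imports Main "HOL-Library.FuncSet"
begin

(* Points of the product of S 1, ..., S n are extensional functions on {1..n}. The factors are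
   arbitrary sets (possibly infinite or empty) over a common type. *)
definition prod_space :: "nat \<Rightarrow> (nat \<Rightarrow> 'a set) \<Rightarrow> (nat \<Rightarrow> 'a) set" where
  "prod_space n S = (\<Pi>\<^sub>E i\<in>{1..n}. S i)"

definition cylinder :: "nat \<Rightarrow> (nat \<Rightarrow> 'a set) \<Rightarrow> nat set \<Rightarrow> (nat \<Rightarrow> 'a) \<Rightarrow> (nat \<Rightarrow> 'a) set" where
  "cylinder n S K x = {y \<in> prod_space n S. \<forall>i\<in>K. y i = x i}"

definition box :: "nat \<Rightarrow> (nat \<Rightarrow> 'a set) \<Rightarrow> (nat \<Rightarrow> 'a) set \<Rightarrow> (nat \<Rightarrow> 'a) set \<Rightarrow> (nat \<Rightarrow> 'a) set" where
  "box n S A B = {x \<in> prod_space n S.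
     \<exists>K L. K \<subseteq> {1..n} \<and> L \<subseteq> {1..n} \<and> K \<inter> L = {} \<and>
           cylinder n S K x \<subseteq> A \<and> cylinder n S L x \<subseteq> B}"

(* The bound card K < n renders |K| <= n - 1 without truncated subtraction. *)
definition cyl_core :: "nat \<Rightarrow> (nat \<Rightarrow> 'a set) \<Rightarrow> (nat \<Rightarrow> 'a) set \<Rightarrow> (nat \<Rightarrow> 'a) set" where
  "cyl_core n S E = \<Union> {cylinder n S K x | x K.
     x \<in> prod_space n S \<and> K \<subseteq> {1..n} \<and> card K < n \<and> cylinder n S K x \<subseteq> E}"

end

theory Submission
  imports Defs
begin

(* If [x]_K is contained in A and [x]_L in B with B proper, then L is nonempty, so that K,
   being disjoint from L, has at most n - 1 elements and [x]_K already lies in the core of A.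
   For minimality, test against the slab B = {w. w i = y i} with i outside K: it is proper as
   soon as S i has two points, and it puts every y in [x]_K into A box B, hence into A1. *)

lemma cylinder_self: "x \<in> prod_space n S \<Longrightarrow> x \<in> cylinder n S K x"
  by (simp add: cylinder_def)

lemma cylinder_empty [simp]: "cylinder n S {} x = prod_space n S"
  by (simp add: cylinder_def)

text \<open>For fixed \<open>K\<close>, agreeing on \<open>K\<close> is an equivalence relation, so
  any point of a class can serve as its base point. This allows recentring the cylinder that puts a
  point into the core at that point itself.\<close>

lemma cylinder_eq: "y \<in> cylinder n S K x \<Longrightarrow> cylinder n S K y = cylinder n S K x"
  by (auto simp: cylinder_def)

lemma boxI:
  assumes "x \<in> prod_space n S" "K \<subseteq> {1..n}" "L \<subseteq> {1..n}" "K \<inter> L = {}"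
    and "cylinder n S K x \<subseteq> A" "cylinder n S L x \<subseteq> B"
  shows "x \<in> box n S A B"
  unfolding box_def mem_Collect_eq using assms by (intro conjI exI)

lemma boxE:
  assumes "x \<in> box n S A B"
  obtains K L where "x \<in> prod_space n S" "K \<subseteq> {1..n}" "L \<subseteq> {1..n}" "K \<inter> L = {}"
    "cylinder n S K x \<subseteq> A" "cylinder n S L x \<subseteq> B"
  using assms unfolding box_def mem_Collect_eq by (elim conjE exE)

lemma box_mono:
  assumes "A \<subseteq> A'" "B \<subseteq> B'"
  shows "box n S A B \<subseteq> box n S A' B'"
proof
  fix x assume "x \<in> box n S A B"
  then show "x \<in> box n S A' B'"
  proof (rule boxE)
    fix K L assume *: "x \<in> prod_space n S" "K \<subseteq> {1..n}" "L \<subseteq> {1..n}" "K \<inter> L = {}"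
      and AB: "cylinder n S K x \<subseteq> A" "cylinder n S L x \<subseteq> B"
    show ?thesis
      using * AB[THEN subset_trans] assms by (intro boxI[of x n S K L])
  qed
qed

text \<open>The roles of \<open>K\<close> and \<open>L\<close> are interchangeable, so facts about
  one argument carry over to the other.\<close>

lemma box_commute: "box n S A B = box n S B A"
proof -
  have "box n S C D \<subseteq> box n S D C" for C D
  proof
    fix x assume "x \<in> box n S C D"
    then show "x \<in> box n S D C"
    proof (rule boxE)
      fix K L assume "x \<in> prod_space n S" "K \<subseteq> {1..n}" "L \<subseteq> {1..n}" "K \<inter> L = {}"
        "cylinder n S K x \<subseteq> C" "cylinder n S L x \<subseteq> D"
      then show ?thesis
        by (intro boxI[of x n S L K]) (simp_all add: Int_commute)
    qed
  qed
  then show ?thesis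
    by blast
qed

text \<open>Each point lies in all of its own cylinders. In the minimality proof this turns
  membership in a box with a slab into membership in \<open>A1\<close>.\<close>

lemma box_subset_left: "box n S A B \<subseteq> A"
  by (auto elim!: boxE dest: cylinder_self)

lemma cyl_core_subset: "cyl_core n S A \<subseteq> A"
  unfolding cyl_core_def by blast

lemma box_cyl_core_left:
  assumes "B \<subset> prod_space n S"
  shows "box n S (cyl_core n S A) B = box n S A B"
proof
  show "box n S (cyl_core n S A) B \<subseteq> box n S A B"
    by (simp add: box_mono cyl_core_subset)
  show "box n S A B \<subseteq> box n S (cyl_core n S A) B"
  proof
    fix x assume "x \<in> box n S A B"
    then obtain K L where x: "x \<in> prod_space n S"
      and KL: "K \<subseteq> {1..n}" "L \<subseteq> {1..n}" "K \<inter> L = {}"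
      and A: "cylinder n S K x \<subseteq> A" and B: "cylinder n S L x \<subseteq> B"
      by (rule boxE)
    \<comment> \<open>For empty \<open>L\<close> the cylinder would be the whole space, by
      \<open>cylinder_empty\<close>, and could not fit into the proper subset
      \<open>B\<close>.\<close>
    have "L \<noteq> {}"
      using B assms by auto
    then have "K \<subset> {1..n}"
      using KL by blast
    then have "card K < n"
      using psubset_card_mono[of "{1..n}" K] by simp
    then have "cylinder n S K x \<in> {cylinder n S K x | x K.
        x \<in> prod_space n S \<and> K \<subseteq> {1..n} \<and> card K < n \<and> cylinder n S K x \<subseteq> A}"
      using x KL(1) A by blast
    then have "cylinder n S K x \<subseteq> cyl_core n S A"
      unfolding cyl_core_def by (rule Union_upper)
    then show "x \<in> box n S (cyl_core n S A) B"
      using x KL B by (intro boxI[of x n S K L])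
  qed
qed

lemma box_cyl_core_right:
  assumes "A \<subset> prod_space n S"
  shows "box n S A (cyl_core n S B) = box n S A B"
  using box_cyl_core_left[OF assms] box_commute by metis

text \<open>Changing coordinate \<open>i\<close> of \<open>y\<close> to a second value of
  \<open>S i\<close> leaves the slab. As \<open>card\<close> is 0 on infinite sets, having at least
  two points is expressed by the disjunction.\<close>

lemma slab_proper:
  assumes y: "y \<in> prod_space n S" and i: "i \<in> {1..n}"
    and S: "infinite (S i) \<or> card (S i) > 1"
  shows "cylinder n S {i} y \<subset> prod_space n S"
proof -
  have "\<not> S i \<subseteq> {y i}"
  proof
    assume "S i \<subseteq> {y i}"
    then show False
      using S card_mono[of "{y i}" "S i"] finite_subset[of "S i" "{y i}"] by auto
  qed
  then obtain s where s: "s \<in> S i" "s \<noteq> y i"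
    by blast
  \<comment> \<open>The update happens inside {1..n}, so the new point is still extensional.\<close>
  then have "y(i := s) \<in> prod_space n S"
    using y i by (auto simp: prod_space_def PiE_iff extensional_def)
  moreover have "y(i := s) \<notin> cylinder n S {i} y"
    using s by (simp add: cylinder_def)
  ultimately show ?thesis
    unfolding cylinder_def by blast
qed

lemma cyl_core_least:
  assumes S: "\<forall>i\<in>{1..n}. infinite (S i) \<or> card (S i) > 1"
    and box: "\<And>B. B \<subset> prod_space n S \<Longrightarrow> box n S A B \<subseteq> box n S A1 B"
  shows "cyl_core n S A \<subseteq> A1"
proof
  fix y assume "y \<in> cyl_core n S A"
  then obtain x K where K: "K \<subseteq> {1..n}" "card K < n" and A: "cylinder n S K x \<subseteq> A"
    and yx: "y \<in> cylinder n S K x"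
    unfolding cyl_core_def by blast
  have y: "y \<in> prod_space n S"
    using yx by (simp add: cylinder_def)
  \<comment> \<open>The full index set has exactly n elements, whereas
    \<open>card K < n\<close>.\<close>
  have "K \<noteq> {1..n}"
    using K(2) by auto
  then obtain i where i: "i \<in> {1..n}" "i \<notin> K"
    using K(1) by blast
  \<comment> \<open>The slab is taken through \<open>y\<close> rather than \<open>x\<close>, because
    both cylinders in the box must have the same base point.\<close>
  define B where "B = cylinder n S {i} y"
  have "cylinder n S K y \<subseteq> A"
    using A cylinder_eq[OF yx] by simp
  moreover have "{i} \<subseteq> {1..n}" "K \<inter> {i} = {}"
    using i by auto
  ultimately have "y \<in> box n S A B"
    unfolding B_def using y K(1) by (intro boxI[of y n S K "{i}"]) simp_all
  moreover have "B \<subset> prod_space n S"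
    unfolding B_def using slab_proper[of y n S i] y i(1) S by blast
  ultimately show "y \<in> A1"
    using box[of B] box_subset_left[of n S A1 B] by blast
qed

theorem proposition3p1:
  fixes n :: nat and S :: "nat \<Rightarrow> 'a set"
  assumes "n \<ge> 1"
  shows
    "(\<forall>A. A \<subseteq> prod_space n S \<longrightarrow>
        cyl_core n S A \<subseteq> A \<and>
        (\<forall>B. B \<subseteq> prod_space n S \<and> B \<noteq> prod_space n S \<longrightarrow>
           box n S A B = box n S (cyl_core n S A) B))
     \<and>
     (\<forall>A B. A \<subset> prod_space n S \<and> B \<subset> prod_space n S \<longrightarrow>
        box n S A B = box n S (cyl_core n S A) B \<and>
        box n S (cyl_core n S A) B = box n S A (cyl_core n S B) \<and>
        box n S A (cyl_core n S B) = box n S (cyl_core n S A) (cyl_core n S B))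
     \<and>
     ((\<forall>i\<in>{1..n}. infinite (S i) \<or> card (S i) > 1) \<longrightarrow>
        (\<forall>A A1. A \<subseteq> prod_space n S \<and> A1 \<subseteq> prod_space n S \<and>
           (\<forall>B. B \<subseteq> prod_space n S \<and> B \<noteq> prod_space n S \<longrightarrow>
              box n S A B = box n S A1 B) \<longrightarrow>
           cyl_core n S A \<subseteq> A1))"
proof (intro conjI allI impI; (elim conjE)?)
  show "cyl_core n S A \<subseteq> A" for A
    by (rule cyl_core_subset)
next
  fix A B assume "B \<subseteq> prod_space n S" "B \<noteq> prod_space n S"
  then show "box n S A B = box n S (cyl_core n S A) B"
    by (simp add: box_cyl_core_left psubset_eq)
next
  fix A B assume A: "A \<subset> prod_space n S" and B: "B \<subset> prod_space n S"
  \<comment> \<open>Replacing \<open>B\<close> by its core next to the core of \<open>A\<close>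
    requires that left argument to be proper as well.\<close>
  then have core_A: "cyl_core n S A \<subset> prod_space n S"
    using cyl_core_subset by blast
  show "box n S A B = box n S (cyl_core n S A) B"
    using B by (simp add: box_cyl_core_left)
  \<comment> \<open>Both sides collapse to \<open>box n S A B\<close>, as they do in the last
    equality.\<close>
  show "box n S (cyl_core n S A) B = box n S A (cyl_core n S B)"
    using A B by (simp add: box_cyl_core_left box_cyl_core_right)
  show "box n S A (cyl_core n S B) = box n S (cyl_core n S A) (cyl_core n S B)"
    using A B core_A by (simp add: box_cyl_core_left box_cyl_core_right)
next
  fix A A1
  assume "\<forall>i\<in>{1..n}. infinite (S i) \<or> card (S i) > 1"
    and "\<forall>B. B \<subseteq> prod_space n S \<and> B \<noteq> prod_space n S \<longrightarrow> box n S A B = box n S A1 B"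
  then show "cyl_core n S A \<subseteq> A1"
    by (intro cyl_core_least) (auto simp: psubset_eq)
qed

end
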